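(* Let $\lambda,\lambda'\in\mathbb C^*$ and $\epsilon,\epsilon'\in\{0,1\}$, and let $V$ and $V'$ be two irreducible quasi-finite highest weight modules over the Lie algebra $\mathcal D$ of differential operators on $\mathbb C[t,t^{-1}]$. Then $\Omega(\lambda,\epsilon)\otimes V$ and $\Omega(\lambda',\epsilon')\otimes V'$ are isomorphic as $\mathcal D$-modules if and only if $(\lambda,\epsilon)=(\lambda',\epsilon')$ and $V\cong V'$ as $\mathcal D$-modules.
   Context: All algebras and modules are over $\mathbb C$; $\mathbb N$ denotes the non-negative integers and $\mathbb C^*=\mathbb C\setminus\{0\}$. $\mathcal D_{ass}$ is the associative algebra of all differential operators on $\mathbb C[t,t^{-1}]$. With $D=t\frac{d}{dt}$ it has basis $\{t^mD^n\mid m\in\mathbb Z,n\in\mathbb N\}$ and multiplication $$(t^{m_1}D^{n_1})(t^{m_2}D^{n_2})=\sum_{i=0}^{n_1}\binom{n_1}{i}m_2^i\,t^{m_1+m_2}D^{n_1+n_2-i}$$ (with $0^0=1$). $\mathcal D$ is the Lie algebra with the same underlying space and the commutator bracket. It is $\mathbb Z$-graded by $\mathcal D_i=\mathrm{span}_{\mathbb C}\{t^iD^n\mid n\ge 0\}$; put $\mathcal D_+=\sum_{i>0}\mathcal D_i$. For $\lambda\in\mathbb C^*$ and $\epsilon\in\{0,1\}$, $\Omega(\lambda,\epsilon)$ is the $\mathcal D$-module with underlying space $\mathbb C[x]$ and action $$t^mD^n\cdot f(x)=\beta^{1-n}\lambda^m(x-\epsilon m)^nf(x-m),\qquad \beta=(-1)^{1-\epsilon},$$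 for $f(x)\in\mathbb C[x]$, $m\in\mathbb Z$, $n\in\mathbb N$. An irreducible $\mathcal D$-module $V$ is a highest weight module if there is a nonzero $v\in V$ such that $\mathbb Cv$ is a one-dimensional $\mathcal D_0$-module and $\mathcal D_+v=0$. Such a $V$ is graded, $V=\bigoplus_{j\ge0}V_{-j}$, where $V_{-j}$ is spanned by the vectors $(t^{m_1}D^{n_1})\cdots(t^{m_k}D^{n_k})v$ with $m_1+\cdots+m_k=-j$; $V$ is quasi-finite if every $V_{-j}$ is finite-dimensional. The tensor product carries the usual action $a(u\otimes w)=au\otimes w+u\otimes aw$ for $a\in\mathcal D$. *)

theory Defs
  imports Complex_Main "HOL-Library.Poly_Mapping" "HOL-Computational_Algebra.Polynomial"
begin

section \<open>Complex vector spaces\<close>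

text \<open>The distribution has a type class only for real vector spaces; this is its complex analogue.\<close>

class complex_vector = ab_group_add +
  fixes scaleC :: "complex \<Rightarrow> 'a \<Rightarrow> 'a"  (infixr \<open>*\<^sub>C\<close> 75)
  assumes scaleC_add_right: "a *\<^sub>C (x + y) = a *\<^sub>C x + a *\<^sub>C y"
    and scaleC_add_left: "(a + b) *\<^sub>C x = a *\<^sub>C x + b *\<^sub>C x"
    and scaleC_scaleC: "a *\<^sub>C b *\<^sub>C x = (a * b) *\<^sub>C x"
    and scaleC_one: "1 *\<^sub>C x = x"

global_interpretation complex_vector: vector_space "scaleC :: complex \<Rightarrow> 'a \<Rightarrow> 'a :: complex_vector"
  by unfold_locales (simp_all add: scaleC_add_right scaleC_add_left scaleC_scaleC scaleC_one)

abbreviation clinear :: "('a::complex_vector \<Rightarrow> 'b::complex_vector) \<Rightarrow> bool" where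
  "clinear \<equiv> Vector_Spaces.linear scaleC scaleC"

definition finite_dim :: "'a::complex_vector set \<Rightarrow> bool" where
  "finite_dim S \<longleftrightarrow> (\<exists>B. finite B \<and> complex_vector.span B = S)"

lemma clinearI:
  fixes f :: "'a::complex_vector \<Rightarrow> 'b::complex_vector"
  assumes "\<And>x y. f (x + y) = f x + f y" "\<And>c x. f (c *\<^sub>C x) = c *\<^sub>C f x"
  shows "clinear f"
  using assms by unfold_locales auto

instantiation complex :: complex_vector
begin
definition scaleC_complex :: "complex \<Rightarrow> complex \<Rightarrow> complex" where
  [simp]: "scaleC_complex = (*)"
instance by standard (simp_all add: algebra_simps)
end

instantiation poly :: (complex_vector) complex_vector
begin
definition scaleC_poly :: "complex \<Rightarrow> 'a poly \<Rightarrow> 'a poly" where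
  "scaleC_poly c = map_poly (scaleC c)"
instance
  by standard (auto simp: scaleC_poly_def poly_eq_iff coeff_map_poly
      scaleC_add_right scaleC_add_left scaleC_scaleC scaleC_one)
end

lemma scaleC_poly_eq_smult: "c *\<^sub>C p = smult c p" for p :: "complex poly"
  by (simp add: scaleC_poly_def poly_eq_iff coeff_map_poly)

instantiation poly_mapping :: (type, complex_vector) complex_vector
begin
definition scaleC_poly_mapping :: "complex \<Rightarrow> ('a \<Rightarrow>\<^sub>0 'b) \<Rightarrow> 'a \<Rightarrow>\<^sub>0 'b" where
  "scaleC_poly_mapping c = Poly_Mapping.map (scaleC c)"

lemma lookup_scaleC: "Poly_Mapping.lookup (c *\<^sub>C f) k = c *\<^sub>C Poly_Mapping.lookup f k"
  for f :: "'a \<Rightarrow>\<^sub>0 'b"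
  by (simp add: scaleC_poly_mapping_def map.rep_eq when_def)

instance
  by standard (rule poly_mapping_eqI, simp add: lookup_scaleC lookup_add
      scaleC_add_right scaleC_add_left scaleC_scaleC scaleC_one)+

end

definition lin_ext :: "('k \<Rightarrow> 'a::complex_vector) \<Rightarrow> ('k \<Rightarrow>\<^sub>0 complex) \<Rightarrow> 'a" where
  "lin_ext h f = (\<Sum>k\<in>Poly_Mapping.keys f. Poly_Mapping.lookup f k *\<^sub>C h k)"

lemma lin_ext_superset:
  assumes "finite A" "Poly_Mapping.keys f \<subseteq> A"
  shows "lin_ext h f = (\<Sum>k\<in>A. Poly_Mapping.lookup f k *\<^sub>C h k)"
  unfolding lin_ext_def using assms
  by (intro sum.mono_neutral_left) (auto simp: in_keys_iff)

lemma clinear_lin_ext: "clinear (lin_ext h)"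
proof (rule clinearI)
  fix f g :: "'a \<Rightarrow>\<^sub>0 complex" and c :: complex
  let ?A = "Poly_Mapping.keys f \<union> Poly_Mapping.keys g"
  have "Poly_Mapping.keys (f + g) \<subseteq> ?A" by (rule keys_add)
  then show "lin_ext h (f + g) = lin_ext h f + lin_ext h g"
    by (simp add: lin_ext_superset[of ?A] lookup_add scaleC_add_left sum.distrib)
  have "Poly_Mapping.keys (c *\<^sub>C f) \<subseteq> Poly_Mapping.keys f"
    by (auto simp: in_keys_iff lookup_scaleC)
  then show "lin_ext h (c *\<^sub>C f) = c *\<^sub>C lin_ext h f"
    by (simp add: lin_ext_superset[of "Poly_Mapping.keys f"] lookup_scaleC
        complex_vector.scale_sum_right scaleC_scaleC)
qed

lemma lin_ext_single [simp]: "lin_ext h (Poly_Mapping.single k c) = c *\<^sub>C h k"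
  by (simp add: lin_ext_def)

section \<open>Tensor products\<close>

text \<open>The tensor product over the complex numbers: the free vector space on pairs modulo the
  bilinearity relations.\<close>

definition tensor_relators ::
    "('a::complex_vector \<times> 'b::complex_vector \<Rightarrow>\<^sub>0 complex) set" where
  "tensor_relators =
     {Poly_Mapping.single (u + u', w) 1 - Poly_Mapping.single (u, w) 1
        - Poly_Mapping.single (u', w) 1 | u u' w. True} \<union>
     {Poly_Mapping.single (u, w + w') 1 - Poly_Mapping.single (u, w) 1
        - Poly_Mapping.single (u, w') 1 | u w w'. True} \<union>
     {Poly_Mapping.single (c *\<^sub>C u, w) 1 - c *\<^sub>C Poly_Mapping.single (u, w) 1 | c u w. True} \<union>
     {Poly_Mapping.single (u, c *\<^sub>C w) 1 - c *\<^sub>C Poly_Mapping.single (u, w) 1 | c u w. True}"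

definition tensor_eq ::
    "('a::complex_vector \<times> 'b::complex_vector \<Rightarrow>\<^sub>0 complex) \<Rightarrow> ('a \<times> 'b \<Rightarrow>\<^sub>0 complex) \<Rightarrow> bool" where
  "tensor_eq f g \<longleftrightarrow> f - g \<in> complex_vector.span tensor_relators"

quotient_type (overloaded) ('a, 'b) tensor =
  "'a::complex_vector \<times> 'b::complex_vector \<Rightarrow>\<^sub>0 complex" / tensor_eq
proof (rule equivpI)
  show "reflp (tensor_eq :: ('a \<times> 'b \<Rightarrow>\<^sub>0 complex) \<Rightarrow> _)"
    by (auto simp: reflp_def tensor_eq_def complex_vector.span_zero)
  show "symp (tensor_eq :: ('a \<times> 'b \<Rightarrow>\<^sub>0 complex) \<Rightarrow> _)"
  proof (rule sympI)
    fix f g :: "'a \<times> 'b \<Rightarrow>\<^sub>0 complex"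
    assume "tensor_eq f g"
    then have "- (f - g) \<in> complex_vector.span tensor_relators"
      unfolding tensor_eq_def by (rule complex_vector.span_neg)
    then show "tensor_eq g f" by (simp add: tensor_eq_def)
  qed
  show "transp (tensor_eq :: ('a \<times> 'b \<Rightarrow>\<^sub>0 complex) \<Rightarrow> _)"
  proof (rule transpI)
    fix f g h :: "'a \<times> 'b \<Rightarrow>\<^sub>0 complex"
    assume "tensor_eq f g" "tensor_eq g h"
    then have "(f - g) + (g - h) \<in> complex_vector.span tensor_relators"
      unfolding tensor_eq_def by (rule complex_vector.span_add)
    then show "tensor_eq f h" by (simp add: tensor_eq_def)
  qed
qed

instantiation tensor :: (complex_vector, complex_vector) complex_vector
begin

lift_definition zero_tensor :: "('a, 'b) tensor" is 0 .

lift_definition plus_tensor :: "('a, 'b) tensor \<Rightarrow> ('a, 'b) tensor \<Rightarrow> ('a, 'b) tensor" is plus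
  unfolding tensor_eq_def by (subst add_diff_add) (rule complex_vector.span_add)

lift_definition uminus_tensor :: "('a, 'b) tensor \<Rightarrow> ('a, 'b) tensor" is uminus
  unfolding tensor_eq_def
  by (subst minus_diff_minus) (rule complex_vector.span_neg)

lift_definition minus_tensor :: "('a, 'b) tensor \<Rightarrow> ('a, 'b) tensor \<Rightarrow> ('a, 'b) tensor" is minus
proof -
  fix f f' g g' :: "'a \<times> 'b \<Rightarrow>\<^sub>0 complex"
  assume "tensor_eq f f'" "tensor_eq g g'"
  then have "(f - f') - (g - g') \<in> complex_vector.span tensor_relators"
    unfolding tensor_eq_def by (rule complex_vector.span_diff)
  then show "tensor_eq (f - g) (f' - g')"
    unfolding tensor_eq_def by (simp add: algebra_simps)
qed

lift_definition scaleC_tensor :: "complex \<Rightarrow> ('a, 'b) tensor \<Rightarrow> ('a, 'b) tensor" is scaleC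
  unfolding tensor_eq_def
  by (subst complex_vector.scale_right_diff_distrib[symmetric]) (rule complex_vector.span_scale)

instance
  by standard
    (transfer; simp add: tensor_eq_def complex_vector.span_zero
      scaleC_add_right scaleC_add_left scaleC_scaleC scaleC_one algebra_simps)+

end

lift_definition pure_tensor :: "'a::complex_vector \<Rightarrow> 'b::complex_vector \<Rightarrow> ('a, 'b) tensor"
    (infixr \<open>\<otimes>\<^sub>C\<close> 75)
  is "\<lambda>u w. Poly_Mapping.single (u, w) 1" .

text \<open>The linear map induced by a bilinear map. It is written with a chosen representative,
  and hence is meaningful only for bilinear \<open>h\<close>; see the two lemmas after it.\<close>

definition tensor_lift ::
    "('a::complex_vector \<Rightarrow> 'b::complex_vector \<Rightarrow> 'c::complex_vector) \<Rightarrow> ('a, 'b) tensor \<Rightarrow> 'c" where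
  "tensor_lift h z = lin_ext (\<lambda>(u, w). h u w) (rep_tensor z)"

definition bilin ::
    "('a::complex_vector \<Rightarrow> 'b::complex_vector \<Rightarrow> 'c::complex_vector) \<Rightarrow> bool" where
  "bilin h \<longleftrightarrow> (\<forall>u. clinear (h u)) \<and> (\<forall>w. clinear (\<lambda>u. h u w))"

lemma bilinD:
  assumes "bilin h"
  shows "h (u + u') w = h u w + h u' w" "h u (w + w') = h u w + h u w'"
    "h (c *\<^sub>C u) w = c *\<^sub>C h u w" "h u (c *\<^sub>C w) = c *\<^sub>C h u w"
proof -
  interpret l: Vector_Spaces.linear scaleC scaleC "\<lambda>u. h u w" for w
    using assms by (simp add: bilin_def)
  interpret r: Vector_Spaces.linear scaleC scaleC "h u" for u
    using assms by (simp add: bilin_def)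
  show "h (u + u') w = h u w + h u' w" "h u (w + w') = h u w + h u w'"
    "h (c *\<^sub>C u) w = c *\<^sub>C h u w" "h u (c *\<^sub>C w) = c *\<^sub>C h u w"
    by (rule l.add r.add l.scale r.scale)+
qed

lemma lin_ext_tensor_eq:
  assumes "bilin h" "tensor_eq f g"
  shows "lin_ext (\<lambda>(u, w). h u w) f = lin_ext (\<lambda>(u, w). h u w) g"
proof -
  let ?L = "lin_ext (\<lambda>(u, w). h u w)"
  interpret L: Vector_Spaces.linear scaleC scaleC ?L by (rule clinear_lin_ext)
  have "?L x = 0" if "x \<in> tensor_relators" for x
    using that unfolding tensor_relators_def
    by (auto simp: L.diff L.scale scaleC_one bilinD[OF assms(1)])
  then have "?L (f - g) = 0"
    using assms(2) L.eq_0_on_span unfolding tensor_eq_def by blast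
  then show ?thesis by (simp add: L.diff)
qed

lemma tensor_lift_abs:
  assumes "bilin h"
  shows "tensor_lift h (abs_tensor f) = lin_ext (\<lambda>(u, w). h u w) f"
proof -
  have "abs_tensor (rep_tensor (abs_tensor f)) = abs_tensor f"
    by (rule Quotient3_abs_rep[OF Quotient3_tensor])
  then have "tensor_eq (rep_tensor (abs_tensor f)) f"
    by (simp add: tensor.abs_eq_iff)
  then show ?thesis
    unfolding tensor_lift_def by (rule lin_ext_tensor_eq[OF assms])
qed

lemma tensor_lift_pure:
  assumes "bilin h"
  shows "tensor_lift h (u \<otimes>\<^sub>C w) = h u w"
  by (simp add: pure_tensor.abs_eq tensor_lift_abs[OF assms] scaleC_one)

lemma clinear_tensor_lift:
  assumes "bilin h"
  shows "clinear (tensor_lift h)"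
proof -
  interpret L: Vector_Spaces.linear scaleC scaleC "lin_ext (\<lambda>(u, w). h u w)"
    by (rule clinear_lin_ext)
  show ?thesis
  proof (rule clinearI)
    fix x y :: "('a, 'b) tensor" and c
    obtain f g where "x = abs_tensor f" "y = abs_tensor g"
      by (metis Quotient3_abs_rep[OF Quotient3_tensor])
    then show "tensor_lift h (x + y) = tensor_lift h x + tensor_lift h y"
      "tensor_lift h (c *\<^sub>C x) = c *\<^sub>C tensor_lift h x"
      by (simp_all add: plus_tensor.abs_eq scaleC_tensor.abs_eq tensor_lift_abs[OF assms] L.add L.scale)
  qed
qed

section \<open>The Lie algebra of differential operators on Laurent polynomials\<close>

text \<open>The coefficient of \<open>t\<^sup>m D\<^sup>n\<close>, where \<open>D = t d/dt\<close>, is stored at the index \<open>(m, n)\<close>.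
  The product of differential operators is \<open>diffop_mult\<close>; it is not the convolution
  product that \<open>Poly_Mapping\<close> puts on this type.\<close>

type_synonym diffop = "int \<times> nat \<Rightarrow>\<^sub>0 complex"

definition tD :: "int \<Rightarrow> nat \<Rightarrow> diffop" where
  "tD m n = Poly_Mapping.single (m, n) 1"

definition basis_mult :: "int \<times> nat \<Rightarrow> int \<times> nat \<Rightarrow> diffop" where
  "basis_mult = (\<lambda>(m1, n1) (m2, n2).
     \<Sum>i\<le>n1. (of_nat (n1 choose i) * of_int m2 ^ i) *\<^sub>C tD (m1 + m2) (n1 + n2 - i))"

definition diffop_mult :: "diffop \<Rightarrow> diffop \<Rightarrow> diffop" where
  "diffop_mult a b = lin_ext (\<lambda>k. lin_ext (basis_mult k) b) a"

lemma diffop_mult_tD: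
  "diffop_mult (tD m1 n1) (tD m2 n2) =
     (\<Sum>i\<le>n1. (of_nat (n1 choose i) * of_int m2 ^ i) *\<^sub>C tD (m1 + m2) (n1 + n2 - i))"
  by (simp add: diffop_mult_def tD_def basis_mult_def scaleC_one)

definition diffop_bracket :: "diffop \<Rightarrow> diffop \<Rightarrow> diffop" where
  "diffop_bracket a b = diffop_mult a b - diffop_mult b a"

definition diffop_degree :: "int \<Rightarrow> diffop set" where
  "diffop_degree i = complex_vector.span (range (tD i))"

definition diffop_pos :: "diffop set" where
  "diffop_pos = complex_vector.span (\<Union>i\<in>{0<..}. diffop_degree i)"

section \<open>Modules over the Lie algebra\<close>

definition diffop_module :: "(diffop \<Rightarrow> 'v::complex_vector \<Rightarrow> 'v) \<Rightarrow> bool" where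
  "diffop_module act \<longleftrightarrow> bilin act \<and>
     (\<forall>a b v. act (diffop_bracket a b) v = act a (act b v) - act b (act a v))"

definition module_isomorphic ::
    "(diffop \<Rightarrow> 'v::complex_vector \<Rightarrow> 'v) \<Rightarrow> (diffop \<Rightarrow> 'w::complex_vector \<Rightarrow> 'w) \<Rightarrow> bool" where
  "module_isomorphic act act' \<longleftrightarrow>
     (\<exists>f. clinear f \<and> bij f \<and> (\<forall>a v. f (act a v) = act' a (f v)))"

definition irreducible_module :: "(diffop \<Rightarrow> 'v::complex_vector \<Rightarrow> 'v) \<Rightarrow> bool" where
  "irreducible_module act \<longleftrightarrow> diffop_module act \<and> (\<exists>v::'v. v \<noteq> 0) \<and>
     (\<forall>S. complex_vector.subspace S \<and> (\<forall>a. \<forall>v\<in>S. act a v \<in> S) \<longrightarrow> S = {0} \<or> S = UNIV)"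

definition highest_weight_vector ::
    "(diffop \<Rightarrow> 'v::complex_vector \<Rightarrow> 'v) \<Rightarrow> 'v \<Rightarrow> bool" where
  "highest_weight_vector act v \<longleftrightarrow> v \<noteq> 0 \<and>
     (\<forall>a\<in>diffop_degree 0. act a v \<in> complex_vector.span {v}) \<and>
     (\<forall>a\<in>diffop_pos. act a v = 0)"

definition graded_piece ::
    "(diffop \<Rightarrow> 'v::complex_vector \<Rightarrow> 'v) \<Rightarrow> 'v \<Rightarrow> nat \<Rightarrow> 'v set" where
  "graded_piece act v j = complex_vector.span
     {foldr (\<lambda>(m, n). act (tD m n)) ks v | ks. sum_list (map fst ks) = - int j}"

text \<open>In an irreducible highest weight module the highest weight vector is unique up to scalars,
  so quasi-finiteness does not depend on which \<open>v\<close> is used.\<close>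

definition quasifinite_highest_weight_module ::
    "(diffop \<Rightarrow> 'v::complex_vector \<Rightarrow> 'v) \<Rightarrow> bool" where
  "quasifinite_highest_weight_module act \<longleftrightarrow>
     (\<exists>v. highest_weight_vector act v \<and> (\<forall>j. finite_dim (graded_piece act v j)))"

definition Omega :: "complex \<Rightarrow> nat \<Rightarrow> diffop \<Rightarrow> complex poly \<Rightarrow> complex poly" where
  "Omega lam eps a f = lin_ext (\<lambda>(m, n).
     let beta = (- 1 :: complex) ^ (1 - eps) in
       smult (beta powi (1 - int n) * lam powi m)
         ([:- (of_nat eps * of_int m), 1:] ^ n * pcompose f [:- of_int m, 1:])) a"

lemma Omega_tD:
  assumes "beta = (- 1) ^ (1 - eps)"
  shows "Omega lam eps (tD m n) f =
    smult (beta powi (1 - int n) * lam powi m)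
      ([:- (of_nat eps * of_int m), 1:] ^ n * pcompose f [:- of_int m, 1:])"
  by (simp add: Omega_def tD_def scaleC_one assms Let_def)

definition tensor_act ::
    "(diffop \<Rightarrow> 'v::complex_vector \<Rightarrow> 'v) \<Rightarrow> (diffop \<Rightarrow> 'w::complex_vector \<Rightarrow> 'w) \<Rightarrow>
      diffop \<Rightarrow> ('v, 'w) tensor \<Rightarrow> ('v, 'w) tensor" where
  "tensor_act act act' a = tensor_lift (\<lambda>u w. act a u \<otimes>\<^sub>C w + u \<otimes>\<^sub>C act' a w)"

lemma bilin_pure_tensor: "bilin (\<otimes>\<^sub>C)"
proof -
  have 1: "(u + u') \<otimes>\<^sub>C w = u \<otimes>\<^sub>C w + u' \<otimes>\<^sub>C w" for u u' :: 'a and w :: 'b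
    by transfer (unfold tensor_eq_def diff_diff_add[symmetric], rule complex_vector.span_base,
        unfold tensor_relators_def, blast)
  have 2: "u \<otimes>\<^sub>C (w + w') = u \<otimes>\<^sub>C w + u \<otimes>\<^sub>C w'" for u :: 'a and w w' :: 'b
    by transfer (unfold tensor_eq_def diff_diff_add[symmetric], rule complex_vector.span_base,
        unfold tensor_relators_def, blast)
  have 3: "(c *\<^sub>C u) \<otimes>\<^sub>C w = c *\<^sub>C (u \<otimes>\<^sub>C w)" for c and u :: 'a and w :: 'b
    by transfer (unfold tensor_eq_def, rule complex_vector.span_base,
        unfold tensor_relators_def, blast)
  have 4: "u \<otimes>\<^sub>C (c *\<^sub>C w) = c *\<^sub>C (u \<otimes>\<^sub>C w)" for c and u :: 'a and w :: 'b
    by transfer (unfold tensor_eq_def, rule complex_vector.span_base,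
        unfold tensor_relators_def, blast)
  show ?thesis
    unfolding bilin_def by (auto intro!: clinearI simp: 1 2 3 4)
qed

lemma tensor_act_pure:
  assumes "bilin act" "bilin act'"
  shows "tensor_act act act' a (u \<otimes>\<^sub>C w) = act a u \<otimes>\<^sub>C w + u \<otimes>\<^sub>C act' a w"
proof -
  have "bilin (\<lambda>u w. act a u \<otimes>\<^sub>C w + u \<otimes>\<^sub>C act' a w)"
    unfolding bilin_def
    by (auto intro!: clinearI simp: bilinD[OF assms(1)] bilinD[OF assms(2)]
        bilinD[OF bilin_pure_tensor] scaleC_add_right)
  from tensor_lift_pure[OF this] show ?thesis by (simp add: tensor_act_def)
qed

end

theory Submission
  imports Defs
begin

text \<open>
  Each vector \<open>w\<close> of an irreducible highest weight module is annihilated by all \<open>t\<^sup>m D\<^sup>n\<close> with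
  \<open>m\<close> large, uniformly in \<open>n\<close> (\<open>highest_weight_restricted\<close>). On \<open>\<Omega>(\<lambda>, \<epsilon>) \<otimes> V\<close> an operator
  \<open>t\<^sup>m D\<^sup>n\<close> with \<open>m\<close> large, depending on the tensor, therefore acts on the polynomial factor
  alone, so an isomorphism \<open>F\<close> can be probed with the polynomial modules, in which the operators
  are explicit.

  Taking \<open>n = 0\<close>, the vector \<open>1 \<otimes> w\<close> is an eigenvector of \<open>t\<^sup>m\<close> for every large \<open>m\<close>, with
  eigenvalue \<open>\<beta> \<lambda>\<^sup>m\<close>. Its image \<open>F (1 \<otimes> w)\<close>, read as a polynomial with coefficients in \<open>V'\<close>, is an
  eigenvector for the same eigenvalues, whereas \<open>t\<^sup>m\<close> now acts by \<open>\<beta>' \<lambda>'\<^sup>m\<close> times the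
  substitution \<open>x \<mapsto> x - m\<close>. Leading coefficients give \<open>\<beta> \<lambda>\<^sup>m = \<beta>' \<lambda>'\<^sup>m\<close> for all large \<open>m\<close>,
  hence \<open>\<lambda> = \<lambda>'\<close> and \<open>\<epsilon> = \<epsilon>'\<close>; the polynomial is then invariant under infinitely many shifts,
  hence constant (\<open>late_shift_eigenpoly\<close>). So \<open>F (1 \<otimes> w) = 1 \<otimes> \<tau> w\<close> for a linear map \<open>\<tau>\<close>.

  For a fixed large \<open>m\<close> the polynomials \<open>t\<^sup>m D\<^sup>n \<cdot> 1\<close>, \<open>n \<ge> 0\<close>, span \<open>\<complex>[x]\<close>, so applying
  these operators to \<open>F (1 \<otimes> w) = 1 \<otimes> \<tau> w\<close> gives \<open>F (f \<otimes> w) = f \<otimes> \<tau> w\<close> for all \<open>f\<close>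
  (\<open>hom_pure_tensor\<close>). A map of the form \<open>id \<otimes> \<tau>\<close> commutes with the tensor product action only if \<open>\<tau>\<close> is a module
  homomorphism, and it is bijective only if \<open>\<tau>\<close> is.
\<close>

section \<open>Linear and bilinear maps\<close>

lemma clinearD:
  assumes "clinear f"
  shows "f (x + y) = f x + f y" "f (x - y) = f x - f y" "f (c *\<^sub>C x) = c *\<^sub>C f x" "f 0 = 0"
    "f (sum g A) = (\<Sum>a\<in>A. f (g a))"
proof -
  interpret f: Vector_Spaces.linear scaleC scaleC f by fact
  show "f (x + y) = f x + f y" "f (x - y) = f x - f y" "f (c *\<^sub>C x) = c *\<^sub>C f x" "f 0 = 0"
    "f (sum g A) = (\<Sum>a\<in>A. f (g a))"
    by (rule f.add f.diff f.scale f.zero f.sum)+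
qed

lemma bilin_zero:
  assumes "bilin h"
  shows "h 0 w = 0" "h u 0 = 0"
  using assms clinearD(4) unfolding bilin_def by blast+

lemma poly_mapping_linear_induct [case_names zero add scale base]:
  fixes f :: "'k \<Rightarrow>\<^sub>0 complex"
  assumes "P 0" "\<And>f g. P f \<Longrightarrow> P g \<Longrightarrow> P (f + g)" "\<And>c f. P f \<Longrightarrow> P (c *\<^sub>C f)"
    and "\<And>k. P (Poly_Mapping.single k 1)"
  shows "P f"
proof (induction f rule: Poly_Mapping.update_induct)
  case const
  then show ?case by (rule assms(1))
next
  case (update f a b)
  have "Poly_Mapping.update a b f = f + b *\<^sub>C Poly_Mapping.single a 1"
    using update(1)
    by (intro poly_mapping_eqI)
      (auto simp: lookup_update lookup_add lookup_scaleC lookup_single when_def in_keys_iff)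
  with update show ?case by (simp add: assms)
qed

lemma separating_functional:
  fixes w :: "'v::complex_vector"
  assumes "w \<noteq> 0"
  obtains phi :: "'v \<Rightarrow> complex" where "clinear phi" "phi w \<noteq> 0"
proof -
  interpret vector_space_pair "scaleC :: complex \<Rightarrow> 'v \<Rightarrow> 'v" "scaleC :: complex \<Rightarrow> complex \<Rightarrow> complex"
    by unfold_locales
  have "complex_vector.independent {w}"
    using assms by simp
  from linear_independent_extend[OF this, of "\<lambda>_. 1"] that show ?thesis
    by auto
qed

section \<open>Tensors with a polynomial factor\<close>

lemma tensor_induct [case_names pure add]:
  fixes z :: "('a::complex_vector, 'b::complex_vector) tensor"
  assumes pure: "\<And>u w. P (u \<otimes>\<^sub>C w)" and add: "\<And>x y. P x \<Longrightarrow> P y \<Longrightarrow> P (x + y)"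
  shows "P z"
proof -
  obtain f where z: "z = abs_tensor f"
    by (metis Quotient3_abs_rep[OF Quotient3_tensor])
  \<comment> \<open>Closure of \<open>P\<close> under scaling is not assumed, so the multiples are treated all at once.\<close>
  have "\<forall>c. P (c *\<^sub>C abs_tensor f)"
  proof (induction f rule: poly_mapping_linear_induct)
    case zero
    have "abs_tensor (0 :: 'a \<times> 'b \<Rightarrow>\<^sub>0 complex) = 0" by (simp add: zero_tensor.abs_eq)
    then show ?case using pure[of 0 0] by (simp add: bilin_zero[OF bilin_pure_tensor])
  next
    case (add f g)
    then show ?case using assms(2)
      by (simp add: plus_tensor.abs_eq[symmetric] scaleC_add_right)
  next
    case (scale c f)
    then show ?case by (simp add: scaleC_tensor.abs_eq[symmetric] scaleC_scaleC)
  next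
    case (base k)
    have "c *\<^sub>C abs_tensor (Poly_Mapping.single k 1) = (c *\<^sub>C fst k) \<otimes>\<^sub>C snd k" for c
      by (simp add: bilinD[OF bilin_pure_tensor]) (simp add: pure_tensor.abs_eq)
    then show ?case using pure by metis
  qed
  then show ?thesis using z scaleC_one by metis
qed

text \<open>A tensor in \<open>\<complex>[x] \<otimes> W\<close> is a polynomial with coefficients in \<open>W\<close>. A functional on \<open>W\<close>
  applied to the coefficients turns it into an ordinary polynomial, to which facts about
  degrees and roots apply.\<close>

definition tensor_coeff :: "nat \<Rightarrow> (complex poly, 'w::complex_vector) tensor \<Rightarrow> 'w" where
  "tensor_coeff k = tensor_lift (\<lambda>f w. coeff f k *\<^sub>C w)"

definition slice ::
    "('w::complex_vector \<Rightarrow> complex) \<Rightarrow> (complex poly, 'w) tensor \<Rightarrow> complex poly" where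
  "slice phi = tensor_lift (\<lambda>f w. smult (phi w) f)"

lemma bilin_tensor_coeff: "bilin (\<lambda>f (w :: 'w::complex_vector). coeff f k *\<^sub>C w)"
  unfolding bilin_def
  by (auto intro!: clinearI
      simp: scaleC_add_left scaleC_add_right scaleC_scaleC scaleC_poly_eq_smult mult.commute)

lemma bilin_slice:
  fixes phi :: "'w::complex_vector \<Rightarrow> complex"
  assumes "clinear phi"
  shows "bilin (\<lambda>(f :: complex poly) w. smult (phi w) f)"
  unfolding bilin_def
  by (auto intro!: clinearI
      simp: clinearD[OF assms] smult_add_left smult_add_right scaleC_poly_eq_smult mult.commute)

lemmas clinear_tensor_coeff = clinear_tensor_lift[OF bilin_tensor_coeff, folded tensor_coeff_def]
lemmas tensor_coeff_pure = tensor_lift_pure[OF bilin_tensor_coeff, folded tensor_coeff_def]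
lemmas clinear_slice = clinear_tensor_lift[OF bilin_slice, folded slice_def]
lemmas slice_pure = tensor_lift_pure[OF bilin_slice, folded slice_def]

lemma coeff_slice:
  assumes "clinear phi"
  shows "coeff (slice phi z) k = phi (tensor_coeff k z)"
  by (induction z rule: tensor_induct)
    (simp_all add: slice_pure[OF assms] tensor_coeff_pure clinearD[OF assms]
      clinearD[OF clinear_slice[OF assms]] clinearD[OF clinear_tensor_coeff] mult.commute)

lemma tensor_expansion:
  fixes z :: "(complex poly, 'w::complex_vector) tensor"
  shows "\<exists>N. \<forall>n\<ge>N. z = (\<Sum>k\<le>n. monom 1 k \<otimes>\<^sub>C tensor_coeff k z)"
proof (induction z rule: tensor_induct)
  case (pure f w)
  have lin: "clinear (\<lambda>f. f \<otimes>\<^sub>C w)"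
    using bilin_pure_tensor unfolding bilin_def by blast
  have "f \<otimes>\<^sub>C w = (\<Sum>k\<le>n. monom 1 k \<otimes>\<^sub>C tensor_coeff k (f \<otimes>\<^sub>C w))" if "n \<ge> degree f" for n
  proof -
    have "f = (\<Sum>k\<le>n. coeff f k *\<^sub>C monom 1 k)"
      using poly_as_sum_of_monoms'[OF that] by (simp add: scaleC_poly_eq_smult smult_monom)
    then have "f \<otimes>\<^sub>C w = (\<Sum>k\<le>n. coeff f k *\<^sub>C monom 1 k) \<otimes>\<^sub>C w"
      by (rule arg_cong)
    also have "\<dots> = (\<Sum>k\<le>n. monom 1 k \<otimes>\<^sub>C tensor_coeff k (f \<otimes>\<^sub>C w))"
      by (simp add: clinearD(5)[OF lin] tensor_coeff_pure bilinD[OF bilin_pure_tensor])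
    finally show ?thesis .
  qed
  then show ?case by blast
next
  case (add x y)
  then obtain N N' where
    "\<forall>n\<ge>N. x = (\<Sum>k\<le>n. monom 1 k \<otimes>\<^sub>C tensor_coeff k x)"
    "\<forall>n\<ge>N'. y = (\<Sum>k\<le>n. monom 1 k \<otimes>\<^sub>C tensor_coeff k y)" by blast
  then have "\<forall>n\<ge>max N N'. x + y = (\<Sum>k\<le>n. monom 1 k \<otimes>\<^sub>C tensor_coeff k (x + y))"
    by (simp add: clinearD[OF clinear_tensor_coeff] bilinD[OF bilin_pure_tensor] sum.distrib)
  then show ?case by blast
qed

text \<open>The functionals on \<open>W\<close> separate its points, so the slices determine every coefficient,
  and a tensor is the sum of its coefficients times powers of \<open>x\<close>.\<close>

lemma slices_separate:
  fixes y z :: "(complex poly, 'w::complex_vector) tensor"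
  assumes "\<And>phi. clinear phi \<Longrightarrow> slice phi y = slice phi z"
  shows "y = z"
proof -
  have "tensor_coeff k (y - z) = 0" for k
  proof (rule ccontr)
    assume "tensor_coeff k (y - z) \<noteq> 0"
    then obtain phi :: "'w \<Rightarrow> complex"
      where phi: "clinear phi" "phi (tensor_coeff k (y - z)) \<noteq> 0"
      by (rule separating_functional)
    have "slice phi (y - z) = 0"
      by (simp add: clinearD[OF clinear_slice[OF phi(1)]] assms[OF phi(1)])
    with coeff_slice[OF phi(1), of "y - z" k] phi(2) show False by simp
  qed
  moreover obtain N where "y - z = (\<Sum>k\<le>N. monom 1 k \<otimes>\<^sub>C tensor_coeff k (y - z))"
    using tensor_expansion by blast
  ultimately show ?thesis by (simp add: bilin_zero[OF bilin_pure_tensor])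
qed

lemma one_tensor_eq_iff: "(1 :: complex poly) \<otimes>\<^sub>C u = 1 \<otimes>\<^sub>C w \<longleftrightarrow> u = w"
proof
  assume "(1 :: complex poly) \<otimes>\<^sub>C u = 1 \<otimes>\<^sub>C w"
  then have "tensor_coeff 0 (1 \<otimes>\<^sub>C u) = tensor_coeff 0 (1 \<otimes>\<^sub>C w)" by (rule arg_cong)
  then show "u = w" by (simp add: tensor_coeff_pure)
qed simp

section \<open>The actions on polynomials and on tensor products\<close>

lemma clinear_lin_ext_param:
  assumes "\<And>k. clinear (h k)"
  shows "clinear (\<lambda>f. lin_ext (\<lambda>k. h k f) a)"
  by (rule clinearI)
    (simp_all add: lin_ext_def clinearD[OF assms] scaleC_add_right sum.distrib
      complex_vector.scale_sum_right scaleC_scaleC mult.commute)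

lemma bilin_Omega: "bilin (Omega lam eps)"
  unfolding bilin_def
proof (intro conjI allI)
  show "clinear (\<lambda>a. Omega lam eps a f)" for f
    unfolding Omega_def by (rule clinear_lin_ext)
  have "clinear (\<lambda>f. smult c (p * pcompose f q))" for c and p q :: "complex poly"
    by (rule clinearI)
      (simp_all add: pcompose_add pcompose_smult scaleC_poly_eq_smult smult_add_right
        distrib_left mult.commute)
  then show "clinear (Omega lam eps a)" for a
    unfolding Omega_def Let_def case_prod_unfold by (rule clinear_lin_ext_param)
qed

lemma clinear_tensor_act:
  assumes "bilin act" "bilin act'"
  shows "clinear (tensor_act act act' a)"
proof -
  have "bilin (\<lambda>u w. act a u \<otimes>\<^sub>C w + u \<otimes>\<^sub>C act' a w)"
    unfolding bilin_def
    by (auto intro!: clinearI simp: bilinD[OF assms(1)] bilinD[OF assms(2)]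
        bilinD[OF bilin_pure_tensor] scaleC_add_right)
  then show ?thesis unfolding tensor_act_def by (rule clinear_tensor_lift)
qed

text \<open>A shift keeps the leading coefficient, so the scalars on the two sides agree for all
  \<open>m > M\<close>; two consecutive \<open>m\<close> then determine the base and the prefactor. After cancelling the
  scalars, \<open>g\<close> is invariant under the shifts by \<open>m > M\<close> and takes the value \<open>g(0)\<close> at infinitely
  many integers.\<close>

lemma late_shift_eigenpoly:
  fixes g :: "complex poly"
  assumes "g \<noteq> 0" and nz: "b \<noteq> 0" "b' \<noteq> 0" "lam \<noteq> 0" "lam' \<noteq> 0"
    and eig: "\<And>m. m > M \<Longrightarrow> smult (b * lam powi m) g
        = smult (b' * lam' powi m) (pcompose g [:- of_int m, 1:])"
  shows "lam = lam'" "b = b'" "g = [:coeff g 0:]"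
proof -
  have eq: "b * lam powi m = b' * lam' powi m" if "m > M" for m
  proof -
    have "coeff (pcompose g [:- of_int m, 1:]) (degree g) = lead_coeff g"
      using lead_coeff_comp[of "[:- of_int m, 1:]" g] by (simp add: degree_pcompose)
    with arg_cong[OF eig[OF that], of "\<lambda>h. coeff h (degree g)"] \<open>g \<noteq> 0\<close> show ?thesis
      by simp
  qed
  obtain N where N: "N > M" using gt_ex by blast
  have "(b * lam powi N) * lam = (b' * lam' powi N) * lam'"
    using eq[of "N + 1"] N nz by (simp add: power_int_add_1 mult.assoc)
  then show lam: "lam = lam'" using eq[OF N] nz by simp
  show "b = b'" using eq[OF N] nz lam by simp
  have "poly (g - [:coeff g 0:]) (of_int m) = 0" if "m > M" for m
  proof -
    have "smult (b * lam powi m) (g - pcompose g [:- of_int m, 1:]) = 0"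
      using eig[OF that] eq[OF that] by (simp add: smult_diff_right)
    then have "g = pcompose g [:- of_int m, 1:]" using nz by simp
    from arg_cong[OF this, of "\<lambda>h. poly h (of_int m)"]
    have "poly g (of_int m) = poly g 0" by (simp add: poly_pcompose)
    then show ?thesis by (simp add: poly_0_coeff_0)
  qed
  then have "of_int ` {M<..} \<subseteq> {x. poly (g - [:coeff g 0:]) x = 0}" by auto
  moreover have "infinite ((of_int :: int \<Rightarrow> complex) ` {M<..})"
    by (simp add: finite_image_iff inj_on_def infinite_Ioi)
  ultimately have "g - [:coeff g 0:] = 0"
    using finite_subset poly_roots_finite by blast
  then show "g = [:coeff g 0:]" by simp
qed

text \<open>Powers of a monic linear polynomial \<open>r\<close> span \<open>\<complex>[x]\<close>, because every polynomial \<open>f\<close>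
  is a polynomial in \<open>r\<close>, obtained from \<open>f\<close> by the substitution inverse to \<open>r\<close>.\<close>

lemma linear_powers_induct [case_names add scale power]:
  fixes f :: "complex poly"
  assumes add: "\<And>f g. P f \<Longrightarrow> P g \<Longrightarrow> P (f + g)" and scale: "\<And>c f. P f \<Longrightarrow> P (smult c f)"
    and pow: "\<And>n. P ([:- a, 1:] ^ n)"
  shows "P f"
proof -
  define r where "r = [:- a, 1:]"
  have *: "P (r ^ n * pcompose g r)" for n g
  proof (induction g arbitrary: n)
    case 0
    show ?case using scale[OF pow[of 0], of 0] by simp
  next
    case (pCons c g)
    have "P (smult c (r ^ n) + r ^ Suc n * pcompose g r)"
      by (intro add scale pow[folded r_def] pCons.IH)
    then show ?case by (simp add: pcompose_pCons distrib_left mult_ac)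
  qed
  have "pcompose (pcompose f [:a, 1:]) [:- a, 1:] = f"
    by (simp add: pcompose_assoc[symmetric] pcompose_pCons)
  with *[of 0 "pcompose f [:a, 1:]"] show ?thesis by (simp add: r_def)
qed

section \<open>Restricted modules\<close>

definition restricted :: "(diffop \<Rightarrow> 'v::complex_vector \<Rightarrow> 'v) \<Rightarrow> bool" where
  "restricted act \<longleftrightarrow> (\<forall>w. \<exists>M. \<forall>m>M. \<forall>n. act (tD m n) w = 0)"

text \<open>The vectors killed by all \<open>t\<^sup>m D\<^sup>n\<close> with \<open>m\<close> large form a submodule: the commutator of
  \<open>t\<^sup>m D\<^sup>n\<close> with an element of degree \<open>i\<close> has degree \<open>m + i\<close>, which is still large. A highest weight
  vector lies in it, so in the irreducible case it is everything.\<close>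

lemma highest_weight_restricted:
  fixes act :: "diffop \<Rightarrow> 'v::complex_vector \<Rightarrow> 'v"
  assumes "irreducible_module act" "highest_weight_vector act v"
  shows "restricted act"
proof -
  define S where "S = {w. \<exists>M. \<forall>m>M. \<forall>n. act (tD m n) w = 0}"
  have bil: "bilin act"
    and br: "\<And>a b v. act (diffop_bracket a b) v = act a (act b v) - act b (act a v)"
    using assms(1) unfolding irreducible_module_def diffop_module_def by auto
  have linl: "clinear (\<lambda>a. act a w)" and linr: "clinear (act a)" for a w
    using bil unfolding bilin_def by auto
  have add: "x + y \<in> S" if xy: "x \<in> S" "y \<in> S" for x y
  proof -
    obtain M M' where "\<forall>m>M. \<forall>n. act (tD m n) x = 0" "\<forall>m>M'. \<forall>n. act (tD m n) y = 0"
      using xy unfolding S_def by blast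
    then have "\<forall>m>max M M'. \<forall>n. act (tD m n) (x + y) = 0"
      by (simp add: clinearD[OF linr])
    then show ?thesis unfolding S_def by blast
  qed
  have zero: "0 \<in> S" by (simp add: S_def clinearD[OF linr])
  have scale: "c *\<^sub>C x \<in> S" if "x \<in> S" for c x
    using that unfolding S_def by (fastforce simp: clinearD[OF linr])
  have tD: "act (tD i k) w \<in> S" if w: "w \<in> S" for i k w
  proof -
    from w obtain M where M: "\<And>m n. m > M \<Longrightarrow> act (tD m n) w = 0"
      unfolding S_def by blast
    have "act (tD m n) (act (tD i k) w) = 0" if m: "m > max M (M - i)" for m n
    proof -
      have "act (diffop_bracket (tD m n) (tD i k)) w = 0"
        using m
        by (simp add: diffop_bracket_def diffop_mult_tD clinearD[OF linl] M)
      moreover have "act (tD i k) (act (tD m n) w) = 0"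
        using m by (simp add: M clinearD[OF linr])
      ultimately show ?thesis by (simp add: br)
    qed
    then show ?thesis unfolding S_def by blast
  qed
  have "act a w \<in> S" if w: "w \<in> S" for a w
  proof (induction a rule: poly_mapping_linear_induct)
    case (base k)
    then show ?case using tD[OF w, of "fst k" "snd k"] by (simp add: tD_def)
  qed (simp_all add: clinearD[OF linl] zero add scale)
  moreover have "complex_vector.subspace S"
    by (intro complex_vector.subspaceI zero add scale)
  ultimately have "S = {0} \<or> S = UNIV"
    using assms(1) unfolding irreducible_module_def by blast
  moreover have "v \<in> S"
  proof -
    have "tD m n \<in> diffop_pos" if "m > 0" for m n
      unfolding diffop_pos_def diffop_degree_def
      using that by (auto intro!: complex_vector.span_base)
    then have "\<forall>m>0. \<forall>n. act (tD m n) v = 0"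
      using assms(2) unfolding highest_weight_vector_def by blast
    then show ?thesis unfolding S_def by blast
  qed
  moreover have "v \<noteq> 0" using assms(2) unfolding highest_weight_vector_def by blast
  ultimately show ?thesis unfolding S_def restricted_def by blast
qed

text \<open>On a given tensor, \<open>t\<^sup>m D\<^sup>n\<close> with \<open>m\<close> large acts on the first factor only. For a general
  tensor this is expressed by slices: the bound on \<open>m\<close> is independent of the functional.\<close>

lemma late_act_pure:
  assumes "bilin act" "restricted act"
  shows "\<exists>M. \<forall>m>M. \<forall>n. \<forall>f. tensor_act (Omega lam eps) act (tD m n) (f \<otimes>\<^sub>C w)
    = Omega lam eps (tD m n) f \<otimes>\<^sub>C w"
proof -
  obtain M where "\<forall>m>M. \<forall>n. act (tD m n) w = 0"
    using assms(2) unfolding restricted_def by blast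
  then have "\<forall>m>M. \<forall>n. \<forall>f. tensor_act (Omega lam eps) act (tD m n) (f \<otimes>\<^sub>C w)
    = Omega lam eps (tD m n) f \<otimes>\<^sub>C w"
    by (simp add: tensor_act_pure[OF bilin_Omega assms(1)] bilin_zero[OF bilin_pure_tensor])
  then show ?thesis by blast
qed

lemma late_act_slice:
  assumes "bilin act" "restricted act"
  shows "\<exists>M. \<forall>m>M. \<forall>n. \<forall>phi. clinear phi \<longrightarrow>
    slice phi (tensor_act (Omega lam eps) act (tD m n) z) = Omega lam eps (tD m n) (slice phi z)"
proof (induction z rule: tensor_induct)
  case (pure f w)
  have lin: "clinear (Omega lam eps a)" for a
    using bilin_Omega unfolding bilin_def by blast
  obtain M where M: "\<forall>m>M. \<forall>n. \<forall>f. tensor_act (Omega lam eps) act (tD m n) (f \<otimes>\<^sub>C w)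
      = Omega lam eps (tD m n) f \<otimes>\<^sub>C w"
    using late_act_pure[OF assms] by blast
  show ?case
    by (intro exI[of _ M] allI impI)
      (simp add: M slice_pure clinearD(3)[OF lin, unfolded scaleC_poly_eq_smult])
next
  case (add x y)
  then obtain M M' where
    "\<forall>m>M. \<forall>n. \<forall>phi. clinear phi \<longrightarrow>
      slice phi (tensor_act (Omega lam eps) act (tD m n) x) = Omega lam eps (tD m n) (slice phi x)"
    "\<forall>m>M'. \<forall>n. \<forall>phi. clinear phi \<longrightarrow>
      slice phi (tensor_act (Omega lam eps) act (tD m n) y) = Omega lam eps (tD m n) (slice phi y)"
    by blast
  then show ?case
    by (intro exI[of _ "max M M'"] allI impI)
      (simp add: clinearD[OF clinear_slice] clinearD[OF clinear_tensor_act[OF bilin_Omega assms(1)]]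
        bilinD[OF bilin_Omega])
qed

section \<open>Homomorphisms between the tensor products\<close>

lemma neg_one_power_parity:
  fixes e e' :: nat
  assumes "e \<in> {0, 1}" "e' \<in> {0, 1}" "(- 1 :: complex) ^ (1 - e) = (- 1) ^ (1 - e')"
  shows "e = e'"
  using assms by auto

text \<open>A homomorphism \<open>F\<close> maps \<open>1 \<otimes> w\<close> to a simultaneous eigenvector of the \<open>t\<^sup>m\<close> with \<open>m\<close>
  large. On a slice of the image these operators are multiples of shifts, so a nonzero slice
  falls under \<open>late_shift_eigenpoly\<close>.\<close>

lemma hom_one_tensor_slice:
  fixes F :: "(complex poly, 'v::complex_vector) tensor \<Rightarrow> (complex poly, 'w::complex_vector) tensor"
  assumes nz: "lam \<noteq> 0" "lam' \<noteq> 0"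
    and V: "bilin V" "restricted V" and V': "bilin V'" "restricted V'"
    and F: "clinear F"
      "\<And>a z. F (tensor_act (Omega lam eps) V a z) = tensor_act (Omega lam' eps') V' a (F z)"
    and phi: "clinear phi" "slice phi (F (1 \<otimes>\<^sub>C w)) \<noteq> 0"
  shows "lam = lam'" "(- 1 :: complex) ^ (1 - eps) = (- 1) ^ (1 - eps')"
    "slice phi (F (1 \<otimes>\<^sub>C w)) = [:phi (tensor_coeff 0 (F (1 \<otimes>\<^sub>C w))):]"
proof -
  define Z where "Z = F (1 \<otimes>\<^sub>C w)"
  define b b' where "b = (- 1 :: complex) ^ (1 - eps)" and "b' = (- 1 :: complex) ^ (1 - eps')"
  have b: "b \<noteq> 0" "b' \<noteq> 0" by (simp_all add: b_def b'_def)
  obtain M where M: "\<And>m f. m > M \<Longrightarrow> tensor_act (Omega lam eps) V (tD m 0) (f \<otimes>\<^sub>C w)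
      = Omega lam eps (tD m 0) f \<otimes>\<^sub>C w"
    using late_act_pure[OF V] by metis
  obtain M' where M': "\<And>m. m > M' \<Longrightarrow> slice phi (tensor_act (Omega lam' eps') V' (tD m 0) Z)
      = Omega lam' eps' (tD m 0) (slice phi Z)"
    using late_act_slice[OF V'] phi(1) by metis
  have eig: "smult (b * lam powi m) (slice phi Z)
      = smult (b' * lam' powi m) (pcompose (slice phi Z) [:- of_int m, 1:])"
    if m: "m > max M M'" for m
  proof -
    have "Omega lam eps (tD m 0) 1 = (b * lam powi m) *\<^sub>C 1"
      by (simp add: Omega_tD[OF b_def] scaleC_poly_eq_smult pcompose_1)
    then have "F (tensor_act (Omega lam eps) V (tD m 0) (1 \<otimes>\<^sub>C w)) = (b * lam powi m) *\<^sub>C Z"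
      using m by (simp add: M bilinD[OF bilin_pure_tensor] clinearD[OF F(1)] Z_def)
    then have "(b * lam powi m) *\<^sub>C Z = tensor_act (Omega lam' eps') V' (tD m 0) Z"
      by (simp add: F(2) Z_def)
    from arg_cong[OF this, of "slice phi"]
    have "smult (b * lam powi m) (slice phi Z) = Omega lam' eps' (tD m 0) (slice phi Z)"
      using m by (simp add: M' clinearD[OF clinear_slice[OF phi(1)]] scaleC_poly_eq_smult)
    then show ?thesis by (simp add: Omega_tD[OF b'_def])
  qed
  note * = late_shift_eigenpoly[where M = "max M M'", OF phi(2)[folded Z_def] b nz eig]
  show "lam = lam'" "(- 1 :: complex) ^ (1 - eps) = (- 1) ^ (1 - eps')"
    using *(1,2) by (simp_all add: b_def b'_def)
  show "slice phi (F (1 \<otimes>\<^sub>C w)) = [:phi (tensor_coeff 0 (F (1 \<otimes>\<^sub>C w))):]"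
    using *(3) coeff_slice[OF phi(1), of Z 0] by (simp add: Z_def)
qed

lemma hom_one_tensor:
  fixes F :: "(complex poly, 'v::complex_vector) tensor \<Rightarrow> (complex poly, 'w::complex_vector) tensor"
  assumes "lam \<noteq> 0" "lam' \<noteq> 0" "bilin V" "restricted V" "bilin V'" "restricted V'"
    and "clinear F"
      "\<And>a z. F (tensor_act (Omega lam eps) V a z) = tensor_act (Omega lam' eps') V' a (F z)"
  shows "F (1 \<otimes>\<^sub>C w) = 1 \<otimes>\<^sub>C tensor_coeff 0 (F (1 \<otimes>\<^sub>C w))"
proof (rule slices_separate)
  fix phi :: "'w \<Rightarrow> complex" assume phi: "clinear phi"
  have "slice phi (F (1 \<otimes>\<^sub>C w)) = [:phi (tensor_coeff 0 (F (1 \<otimes>\<^sub>C w))):]"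
  proof (cases "slice phi (F (1 \<otimes>\<^sub>C w)) = 0")
    case True
    then show ?thesis using coeff_slice[OF phi, of "F (1 \<otimes>\<^sub>C w)" 0] by simp
  next
    case False
    from hom_one_tensor_slice(3)[OF assms phi this] show ?thesis .
  qed
  then show "slice phi (F (1 \<otimes>\<^sub>C w)) = slice phi (1 \<otimes>\<^sub>C tensor_coeff 0 (F (1 \<otimes>\<^sub>C w)))"
    by (simp add: slice_pure[OF phi])
qed

text \<open>Up to a nonzero factor, \<open>t\<^sup>m D\<^sup>n\<close> maps \<open>1\<close> to \<open>(x - \<epsilon> m)\<^sup>n\<close>. With \<open>m\<close> fixed and large,
  these vectors carry the formula from \<open>1 \<otimes> w\<close> to all of \<open>\<complex>[x] \<otimes> w\<close>.\<close>

lemma hom_pure_tensor: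
  fixes F :: "(complex poly, 'v::complex_vector) tensor \<Rightarrow> (complex poly, 'w::complex_vector) tensor"
  assumes nz: "lam \<noteq> 0" and V: "bilin V" "restricted V" and V': "bilin V'" "restricted V'"
    and F: "clinear F"
      "\<And>a z. F (tensor_act (Omega lam eps) V a z) = tensor_act (Omega lam eps) V' a (F z)"
    and one: "F (1 \<otimes>\<^sub>C w) = 1 \<otimes>\<^sub>C u"
  shows "F (f \<otimes>\<^sub>C w) = f \<otimes>\<^sub>C u"
proof -
  obtain M where M: "\<And>m n f. m > M \<Longrightarrow> tensor_act (Omega lam eps) V (tD m n) (f \<otimes>\<^sub>C w)
      = Omega lam eps (tD m n) f \<otimes>\<^sub>C w"
    using late_act_pure[OF V] by metis
  obtain M' where M': "\<And>m n f. m > M' \<Longrightarrow> tensor_act (Omega lam eps) V' (tD m n) (f \<otimes>\<^sub>C u)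
      = Omega lam eps (tD m n) f \<otimes>\<^sub>C u"
    using late_act_pure[OF V'] by metis
  define m where "m = max M M' + 1"
  have m: "m > M" "m > M'" by (simp_all add: m_def)
  show ?thesis
  proof (induction f rule: linear_powers_induct[where a = "of_nat eps * of_int m"])
    case (add f g)
    then show ?case by (simp add: bilinD[OF bilin_pure_tensor] clinearD[OF F(1)])
  next
    case (scale c f)
    then show ?case
      by (simp add: bilinD[OF bilin_pure_tensor] clinearD[OF F(1)] flip: scaleC_poly_eq_smult)
  next
    case (power n)
    let ?r = "[:- (of_nat eps * of_int m), 1:] ^ n :: complex poly"
    define c where "c = ((- 1 :: complex) ^ (1 - eps)) powi (1 - int n) * lam powi m"
    have c: "c \<noteq> 0" using nz by (simp add: c_def)
    have r: "Omega lam eps (tD m n) 1 = c *\<^sub>C ?r"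
      by (simp add: Omega_tD[OF refl] c_def scaleC_poly_eq_smult pcompose_1)
    have "F (tensor_act (Omega lam eps) V (tD m n) (1 \<otimes>\<^sub>C w))
        = tensor_act (Omega lam eps) V' (tD m n) (1 \<otimes>\<^sub>C u)"
      by (simp add: F(2) one)
    then have "c *\<^sub>C F (?r \<otimes>\<^sub>C w) = c *\<^sub>C (?r \<otimes>\<^sub>C u)"
      by (simp add: M[OF m(1)] M'[OF m(2)] r bilinD[OF bilin_pure_tensor] clinearD[OF F(1)])
    then show ?case using c by simp
  qed
qed

text \<open>The isomorphism is \<open>id \<otimes> \<tau>\<close>, so \<open>\<tau>\<close> can be read off the constant coefficients: this
  transfers surjectivity, and comparing actions on \<open>1 \<otimes> w\<close> shows that \<open>\<tau>\<close> is a homomorphism.\<close>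

lemma isomorphic_imp_isomorphic_factor:
  fixes V :: "diffop \<Rightarrow> 'v::complex_vector \<Rightarrow> 'v" and V' :: "diffop \<Rightarrow> 'w::complex_vector \<Rightarrow> 'w"
  assumes nz: "lam \<noteq> 0" and V: "bilin V" "restricted V" and V': "bilin V'" "restricted V'"
    and iso: "module_isomorphic (tensor_act (Omega lam eps) V) (tensor_act (Omega lam eps) V')"
  shows "module_isomorphic V V'"
proof -
  obtain F where F: "clinear F" "bij F"
      "\<And>a z. F (tensor_act (Omega lam eps) V a z) = tensor_act (Omega lam eps) V' a (F z)"
    using iso unfolding module_isomorphic_def by blast
  define tau where "tau w = tensor_coeff 0 (F (1 \<otimes>\<^sub>C w))" for w
  have pure: "F (f \<otimes>\<^sub>C w) = f \<otimes>\<^sub>C tau w" for f w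
    using hom_pure_tensor[OF nz V V' F(1,3)] hom_one_tensor[OF nz nz V V' F(1,3), of w]
    unfolding tau_def by blast
  have lin: "clinear tau"
    unfolding tau_def
    by (rule clinearI)
      (simp_all add: bilinD[OF bilin_pure_tensor] clinearD[OF F(1)] clinearD[OF clinear_tensor_coeff])
  have coeff: "tensor_coeff 0 (F z) = tau (tensor_coeff 0 z)" for z
    by (induction z rule: tensor_induct)
      (simp_all add: pure tensor_coeff_pure clinearD[OF lin] clinearD[OF F(1)]
        clinearD[OF clinear_tensor_coeff])
  have "inj tau"
  proof (rule injI)
    fix u w assume "tau u = tau w"
    then have "F (1 \<otimes>\<^sub>C u) = F (1 \<otimes>\<^sub>C w)" by (simp add: pure)
    then show "u = w" using bij_is_inj[OF F(2)] by (simp add: inj_eq one_tensor_eq_iff)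
  qed
  moreover have "surj tau"
  proof (rule surjI)
    fix u
    have "F (inv F (1 \<otimes>\<^sub>C u)) = 1 \<otimes>\<^sub>C u"
      using bij_is_surj[OF F(2)] by (rule surj_f_inv_f)
    with coeff[of "inv F (1 \<otimes>\<^sub>C u)"]
    show "tau (tensor_coeff 0 (inv F (1 \<otimes>\<^sub>C u))) = u"
      by (simp add: tensor_coeff_pure scaleC_one)
  qed
  moreover have "tau (V a w) = V' a (tau w)" for a w
    using F(3)[of a "1 \<otimes>\<^sub>C w"]
    by (simp add: tensor_act_pure[OF bilin_Omega V(1)] tensor_act_pure[OF bilin_Omega V'(1)]
        clinearD[OF F(1)] pure one_tensor_eq_iff)
  ultimately show ?thesis
    unfolding module_isomorphic_def bij_def using lin by blast
qed

lemma isomorphic_parameters: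
  fixes V :: "diffop \<Rightarrow> 'v::complex_vector \<Rightarrow> 'v" and V' :: "diffop \<Rightarrow> 'w::complex_vector \<Rightarrow> 'w"
  assumes nz: "lam \<noteq> 0" "lam' \<noteq> 0" and eps: "eps \<in> {0, 1}" "eps' \<in> {0, 1}"
    and V: "bilin V" "restricted V" and V': "bilin V'" "restricted V'"
    and nontrivial: "\<exists>v::'v. v \<noteq> 0"
    and iso: "module_isomorphic (tensor_act (Omega lam eps) V) (tensor_act (Omega lam' eps') V')"
  shows "lam = lam'" "eps = eps'"
proof -
  obtain F where F: "clinear F" "bij F"
      "\<And>a z. F (tensor_act (Omega lam eps) V a z) = tensor_act (Omega lam' eps') V' a (F z)"
    using iso unfolding module_isomorphic_def by blast
  obtain w :: 'v where "w \<noteq> 0" using nontrivial by blast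
  then have "1 \<otimes>\<^sub>C w \<noteq> (0 :: (complex poly, 'v) tensor)"
    using one_tensor_eq_iff[of w 0] by (simp add: bilin_zero[OF bilin_pure_tensor])
  then have "F (1 \<otimes>\<^sub>C w) \<noteq> F 0"
    using bij_is_inj[OF F(2)] by (simp add: inj_eq)
  then obtain phi :: "'w \<Rightarrow> complex"
    where phi: "clinear phi" "slice phi (F (1 \<otimes>\<^sub>C w)) \<noteq> slice phi (F 0)"
    using slices_separate by blast
  then have "slice phi (F (1 \<otimes>\<^sub>C w)) \<noteq> 0"
    by (simp add: clinearD(4)[OF F(1)] clinearD(4)[OF clinear_slice[OF phi(1)]])
  note * = hom_one_tensor_slice[OF nz V V' F(1,3) phi(1) this]
  show "lam = lam'" "eps = eps'"
    by (rule *(1) neg_one_power_parity[OF eps *(2)])+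
qed

lemma isomorphic_tensor:
  fixes act :: "diffop \<Rightarrow> 'u::complex_vector \<Rightarrow> 'u"
    and V :: "diffop \<Rightarrow> 'v::complex_vector \<Rightarrow> 'v" and V' :: "diffop \<Rightarrow> 'w::complex_vector \<Rightarrow> 'w"
  assumes act: "bilin act" "bilin V" "bilin V'" and iso: "module_isomorphic V V'"
  shows "module_isomorphic (tensor_act act V) (tensor_act act V')"
proof -
  obtain f where f: "clinear f" "bij f" "\<And>a v. f (V a v) = V' a (f v)"
    using iso unfolding module_isomorphic_def by blast
  define G where "G = tensor_lift (\<lambda>(p :: 'u) w. p \<otimes>\<^sub>C f w)"
  define H where "H = tensor_lift (\<lambda>(p :: 'u) w. p \<otimes>\<^sub>C inv f w)"
  have inv: "f (inv f x) = x" "inv f (f y) = y" for x y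
    using f(2) by (simp_all add: bij_is_surj surj_f_inv_f bij_is_inj)
  have inv_lin: "clinear (inv f)"
  proof (rule clinearI)
    show "inv f (x + y) = inv f x + inv f y" for x y
      using clinearD(1)[OF f(1), of "inv f x" "inv f y"] inv by metis
    show "inv f (c *\<^sub>C x) = c *\<^sub>C inv f x" for c x
      using clinearD(3)[OF f(1), of c "inv f x"] inv by metis
  qed
  have bil: "bilin (\<lambda>(p :: 'u) w. p \<otimes>\<^sub>C f w)" "bilin (\<lambda>(p :: 'u) w. p \<otimes>\<^sub>C inv f w)"
    unfolding bilin_def
    by (auto intro!: clinearI
        simp: bilinD[OF bilin_pure_tensor] clinearD[OF f(1)] clinearD[OF inv_lin])
  have G: "clinear G" "G (p \<otimes>\<^sub>C w) = p \<otimes>\<^sub>C f w" for p w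
    unfolding G_def by (rule clinear_tensor_lift[OF bil(1)] tensor_lift_pure[OF bil(1)])+
  have H: "clinear H" "H (p \<otimes>\<^sub>C w) = p \<otimes>\<^sub>C inv f w" for p w
    unfolding H_def by (rule clinear_tensor_lift[OF bil(2)] tensor_lift_pure[OF bil(2)])+
  have "H (G z) = z" for z
    by (induction z rule: tensor_induct) (simp_all add: G H inv clinearD[OF G(1)] clinearD[OF H(1)])
  moreover have "G (H z) = z" for z
    by (induction z rule: tensor_induct) (simp_all add: G H inv clinearD[OF G(1)] clinearD[OF H(1)])
  ultimately have "bij G" by (intro bijI' ; metis)
  moreover have "G (tensor_act act V a z) = tensor_act act V' a (G z)" for a z
    by (induction z rule: tensor_induct)
      (simp_all add: G f(3) clinearD[OF G(1)] tensor_act_pure[OF act(1,2)] tensor_act_pure[OF act(1,3)]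
        clinearD[OF clinear_tensor_act[OF act(1,2)]] clinearD[OF clinear_tensor_act[OF act(1,3)]])
  ultimately show ?thesis
    unfolding module_isomorphic_def using G(1) by blast
qed

theorem theorem4p2:
  fixes lam lam' :: complex and eps eps' :: nat
    and V :: "diffop \<Rightarrow> 'v::complex_vector \<Rightarrow> 'v"
    and V' :: "diffop \<Rightarrow> 'w::complex_vector \<Rightarrow> 'w"
  assumes "lam \<noteq> 0" and "lam' \<noteq> 0"
    and "eps \<in> {0, 1}" and "eps' \<in> {0, 1}"
    and "irreducible_module V" and "quasifinite_highest_weight_module V"
    and "irreducible_module V'" and "quasifinite_highest_weight_module V'"
  shows "module_isomorphic (tensor_act (Omega lam eps) V) (tensor_act (Omega lam' eps') V')
    \<longleftrightarrow> (lam, eps) = (lam', eps') \<and> module_isomorphic V V'"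
proof -
  have V: "bilin V" "restricted V"
    using assms(5,6) highest_weight_restricted
    unfolding irreducible_module_def diffop_module_def quasifinite_highest_weight_module_def by blast+
  have V': "bilin V'" "restricted V'"
    using assms(7,8) highest_weight_restricted
    unfolding irreducible_module_def diffop_module_def quasifinite_highest_weight_module_def by blast+
  have ex: "\<exists>v::'v. v \<noteq> 0"
    using assms(5) unfolding irreducible_module_def by blast
  show ?thesis
  proof
    assume iso: "module_isomorphic (tensor_act (Omega lam eps) V) (tensor_act (Omega lam' eps') V')"
    have par: "lam = lam'" "eps = eps'"
      using isomorphic_parameters[OF assms(1-4) V V' ex iso] .
    then show "(lam, eps) = (lam', eps') \<and> module_isomorphic V V'"
      using isomorphic_imp_isomorphic_factor[OF assms(1) V V'] iso by simp
  next
    assume "(lam, eps) = (lam', eps') \<and> module_isomorphic V V'"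
    then show "module_isomorphic (tensor_act (Omega lam eps) V) (tensor_act (Omega lam' eps') V')"
      using isomorphic_tensor[OF bilin_Omega V(1) V'(1)] by simp
  qed
qed

end
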